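(* Let $S$ be a closed (compact, connected, without boundary) orientable surface of genus $g\ge1$ and let $n$ be a positive integer. The map $s:\pi_1(S)\to P_n(S)$ which sends $a_i$ to $A_{i,j_1}$ for $i=1,\dots,2g-1$, and $a_{2g}$ to $B_1B_2\cdots B_n$, is a group section of the projection $p_{n,1}:P_n(S)\to\pi_1(S)$; that is, $s$ extends to a well-defined group homomorphism with $p_{n,1}\circ s=\mathrm{id}_{\pi_1(S)}$.
   Context: Write $[a,b]=aba^{-1}b^{-1}$ and $j_t=2g+t$ for $t=1,\dots,n$. $P_n(S)$ is the pure braid group with $n$ strands on $S$ (fundamental group of the configuration space of ordered $n$-tuples of distinct points of $S$). For $S$ closed orientable of genus $g$, it has a (known) presentation with generators $\{A_{i,j}\mid 1\le i\le 2g+n-1,\ 2g+1\le j\le 2g+n,\ i<j\}$ and relations (PR1) $A_{i,j}^{-1}A_{r,s}A_{i,j}=A_{r,s}$ if $i<j<r<s$, or $r+1<i<j<s$, or ($i=r+1<j<s$ with $r\ge 2g$ or $r$ even); (PR2) $A_{i,j}^{-1}A_{j,s}A_{i,j}=A_{i,s}A_{j,s}A_{i,s}^{-1}$ if $i<j<s$; (PR3) $A_{i,j}^{-1}A_{i,s}A_{i,j}=A_{i,s}A_{j,s}A_{i,s}A_{j,s}^{-1}A_{i,s}^{-1}$ if $i<j<s$; (PR4) $A_{i,j}^{-1}A_{r,s}A_{i,j}=A_{i,s}A_{j,s}A_{i,s}^{-1}A_{j,s}^{-1}A_{r,s}A_{j,s}A_{i,s}A_{j,s}^{-1}A_{i,s}^{-1}$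 if $i+1<r<j<s$, or ($i+1=r<j<s$ with $r>2g$ or $r$ odd); (ER1) $A_{r+1,j}^{-1}A_{r,s}A_{r+1,j}=A_{r,s}A_{r+1,s}A_{j,s}^{-1}A_{r+1,s}^{-1}$ if $r$ odd, $r<2g$, $j<s$; (ER2) $A_{r-1,j}^{-1}A_{r,s}A_{r-1,j}=A_{r-1,s}A_{j,s}A_{r-1,s}^{-1}A_{r,s}A_{j,s}A_{r-1,s}A_{j,s}^{-1}A_{r-1,s}^{-1}$ if $r$ even, $r\le 2g$, $j<s$; (TR) $[A_{2g,2g+k}^{-1},A_{2g-1,2g+k}]\cdots[A_{2,2g+k}^{-1},A_{1,2g+k}]=\prod_{l=2g+1}^{2g+k-1}A_{l,2g+k}\prod_{j=2g+k+1}^{2g+n}A_{2g+k,j}$ for $k=1,\dots,n$ (products taken in increasing order of the index, from left to right). The map $p_{n,1}:P_n(S)\to P_1(S)=\pi_1(S)$ is the homomorphism that forgets the last $n-1$ strands. The fundamental group has presentation $$\pi_1(S)=\langle a_1,\dots,a_{2g}\mid [a_{2g}^{-1},a_{2g-1}][a_{2g-2}^{-1},a_{2g-3}]\cdots[a_2^{-1},a_1]=1\rangle,$$ where $a_i=p_{n,1}(A_{i,j_1})$ for $i=1,\dots,2g$; and $p_{n,1}(A_{i,j})=1$ whenever $j>j_1$. For $k=1,\dots,n$, define $B_k=A_{2g,j_k}A_{j_1,j_k}A_{j_2,j_k}\cdots A_{j_{k-1},j_k}\in P_n(S)$ (so $B_1=A_{2g,j_1}$). *)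

theory Defs
  imports "HOL-Analysis.Analysis" "HOL-Homology.Homology"
begin

section \<open>Closed orientable surfaces\<close>

definition locally_plane :: "'a::topological_space set \<Rightarrow> bool" where
  "locally_plane S \<longleftrightarrow>
     (\<forall>x\<in>S. \<exists>U. openin (top_of_set S) U \<and> x \<in> U \<and> U homeomorphic (UNIV :: (real^2) set))"

definition closed_surface :: "'a::topological_space set \<Rightarrow> bool" where
  "closed_surface S \<longleftrightarrow>
     Hausdorff_space (top_of_set S) \<and> second_countable (top_of_set S) \<and> locally_plane S \<and>
     compact S \<and> connected S \<and> S \<noteq> {}"

text \<open>The local homology group \<open>H\<^sub>2(S, S - U; \<int>)\<close>.\<close>

abbreviation local_homology :: "'a::topological_space set \<Rightarrow> 'a set \<Rightarrow> 'a chain set monoid" where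
  "local_homology S U \<equiv> relative_homology_group 2 (top_of_set S) (S - U)"

text \<open>An orientation is a choice of a generator \<open>\<mu> x\<close> of the (infinite cyclic) local homology group
  at each point \<open>x\<close> which is locally consistent, i.e. locally the restriction of one class.\<close>

definition surface_orientation :: "'a::topological_space set \<Rightarrow> ('a \<Rightarrow> 'a chain set) \<Rightarrow> bool" where
  "surface_orientation S \<mu> \<longleftrightarrow>
     (\<forall>x\<in>S. \<mu> x \<in> carrier (local_homology S {x}) \<and>
            generate (local_homology S {x}) {\<mu> x} = carrier (local_homology S {x})) \<and>
     (\<forall>x\<in>S. \<exists>U. openin (top_of_set S) U \<and> x \<in> U \<and>
        (\<exists>\<alpha> \<in> carrier (local_homology S U).
           \<forall>y\<in>U. hom_induced 2 (top_of_set S) (S - U) (top_of_set S) (S - {y}) id \<alpha> = \<mu> y))"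

definition orientable_surface :: "'a::topological_space set \<Rightarrow> bool" where
  "orientable_surface S \<longleftrightarrow> (\<exists>\<mu>. surface_orientation S \<mu>)"

text \<open>The genus is the largest number of pairwise disjoint simple closed curves along which the
  surface can be cut without becoming disconnected.\<close>

definition nonseparating_curves :: "'a::topological_space set \<Rightarrow> nat \<Rightarrow> (nat \<Rightarrow> real \<Rightarrow> 'a) \<Rightarrow> bool" where
  "nonseparating_curves S k \<gamma> \<longleftrightarrow>
     (\<forall>i<k. simple_path (\<gamma> i) \<and> pathfinish (\<gamma> i) = pathstart (\<gamma> i) \<and> path_image (\<gamma> i) \<subseteq> S) \<and>
     disjoint_family_on (\<lambda>i. path_image (\<gamma> i)) {..<k} \<and>
     connected (S - (\<Union>i<k. path_image (\<gamma> i)))"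

definition has_genus :: "'a::topological_space set \<Rightarrow> nat \<Rightarrow> bool" where
  "has_genus S g \<longleftrightarrow>
     (\<exists>\<gamma>. nonseparating_curves S g \<gamma>) \<and> (\<forall>k \<gamma>. nonseparating_curves S k \<gamma> \<longrightarrow> k \<le> g)"


section \<open>Fundamental groups and pure braid groups\<close>

definition path_class :: "'a::topological_space set \<Rightarrow> (real \<Rightarrow> 'a) \<Rightarrow> (real \<Rightarrow> 'a) set" where
  "path_class X p = {q. homotopic_paths X p q}"

definition loops :: "'a::topological_space set \<Rightarrow> 'a \<Rightarrow> (real \<Rightarrow> 'a) set" where
  "loops X x = {p. path p \<and> path_image p \<subseteq> X \<and> pathstart p = x \<and> pathfinish p = x}"

text \<open>A product of classes is represented by traversing first the left and then the right loop.\<close>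

definition fundamental_group :: "'a::topological_space set \<Rightarrow> 'a \<Rightarrow> (real \<Rightarrow> 'a) set monoid" where
  "fundamental_group X x =
     \<lparr>carrier = path_class X ` loops X x,
      mult = (\<lambda>P Q. {r. \<exists>p\<in>P. \<exists>q\<in>Q. homotopic_paths X (p +++ q) r}),
      one = path_class X (\<lambda>t. x)\<rparr>"

text \<open>The map sending the class of \<open>p\<close> to the class of \<open>f \<circ> p\<close> in \<open>Y\<close>.\<close>

definition fundamental_group_map ::
  "'b::topological_space set \<Rightarrow> ('a::topological_space \<Rightarrow> 'b) \<Rightarrow> (real \<Rightarrow> 'a) set \<Rightarrow> (real \<Rightarrow> 'b) set" where
  "fundamental_group_map Y f P = {r. \<exists>p\<in>P. homotopic_paths Y (f \<circ> p) r}"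

text \<open>The configurations of \<open>n\<close> ordered points. Functions carry the product topology, and
  \<open>Pi\<^sub>E\<close> fixes the irrelevant values outside \<open>{1..n}\<close>, so this is a subspace of \<open>S\<^sup>n\<close>.\<close>

definition configuration_space :: "nat \<Rightarrow> 'a::topological_space set \<Rightarrow> (nat \<Rightarrow> 'a) set" where
  "configuration_space n S = {x \<in> {1..n} \<rightarrow>\<^sub>E S. inj_on x {1..n}}"

definition pure_braid_group ::
  "nat \<Rightarrow> 'a::topological_space set \<Rightarrow> (nat \<Rightarrow> 'a) \<Rightarrow> (real \<Rightarrow> nat \<Rightarrow> 'a) set monoid" where
  "pure_braid_group n S x = fundamental_group (configuration_space n S) x"

text \<open>Forgetting all strands but the first one, where \<open>P\<^sub>1(S)\<close> is identified with \<open>\<pi>\<^sub>1(S)\<close>.\<close>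

definition forget_to_first ::
  "'a::topological_space set \<Rightarrow> (real \<Rightarrow> nat \<Rightarrow> 'a) set \<Rightarrow> (real \<Rightarrow> 'a) set" where
  "forget_to_first S = fundamental_group_map S (\<lambda>x. x 1)"


section \<open>Group presentations\<close>

text \<open>A letter \<open>(i, True)\<close> stands for the generator \<open>i\<close>, and \<open>(i, False)\<close> for its inverse.\<close>

type_synonym 'i word = "('i \<times> bool) list"

definition words :: "'i set \<Rightarrow> 'i word set" where
  "words I = lists (I \<times> UNIV)"

definition gen :: "'i \<Rightarrow> 'i word" where
  "gen i = [(i, True)]"

definition winv :: "'i word \<Rightarrow> 'i word" where
  "winv w = rev (map (\<lambda>(i, e). (i, \<not> e)) w)"

definition wcomm :: "'i word \<Rightarrow> 'i word \<Rightarrow> 'i word" where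
  "wcomm u v = u @ v @ winv u @ winv v"

primrec eval_word :: "('a, 'b) monoid_scheme \<Rightarrow> ('i \<Rightarrow> 'a) \<Rightarrow> 'i word \<Rightarrow> 'a" where
  "eval_word G x [] = \<one>\<^bsub>G\<^esub>"
| "eval_word G x (a # w) =
     (if snd a then x (fst a) else inv\<^bsub>G\<^esub> x (fst a)) \<otimes>\<^bsub>G\<^esub> eval_word G x w"

text \<open>Equality of words in the group with generators \<open>I\<close> and defining relations \<open>l = r\<close> for
  \<open>(l, r) \<in> R\<close>.\<close>

inductive presented_eq :: "'i set \<Rightarrow> ('i word \<times> 'i word) set \<Rightarrow> 'i word \<Rightarrow> 'i word \<Rightarrow> bool"
  for I R where
  refl: "w \<in> words I \<Longrightarrow> presented_eq I R w w"
| sym: "presented_eq I R u v \<Longrightarrow> presented_eq I R v u"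
| trans: "presented_eq I R u v \<Longrightarrow> presented_eq I R v w \<Longrightarrow> presented_eq I R u w"
| cancel: "u \<in> words I \<Longrightarrow> v \<in> words I \<Longrightarrow> i \<in> I \<Longrightarrow>
     presented_eq I R (u @ [(i, e), (i, \<not> e)] @ v) (u @ v)"
| relation: "u \<in> words I \<Longrightarrow> v \<in> words I \<Longrightarrow> (l, r) \<in> R \<Longrightarrow>
     presented_eq I R (u @ l @ v) (u @ r @ v)"

text \<open>\<open>G\<close> has the presentation \<open>\<langle>I | R\<rangle>\<close>, where \<open>i \<in> I\<close> corresponds to \<open>x i\<close>: evaluation of words is
  onto and induces an injection on words modulo the relations.\<close>

definition has_presentation ::
  "('a, 'b) monoid_scheme \<Rightarrow> ('i \<Rightarrow> 'a) \<Rightarrow> 'i set \<Rightarrow> ('i word \<times> 'i word) set \<Rightarrow> bool" where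
  "has_presentation G x I R \<longleftrightarrow>
     R \<subseteq> words I \<times> words I \<and> x \<in> I \<rightarrow> carrier G \<and>
     eval_word G x ` words I = carrier G \<and>
     (\<forall>u\<in>words I. \<forall>v\<in>words I. eval_word G x u = eval_word G x v \<longleftrightarrow> presented_eq I R u v)"


section \<open>The presentations of the surface group and of the pure braid groups\<close>

text \<open>The word \<open>[a\<^sub>2\<^sub>g\<inverse>, a\<^sub>2\<^sub>g\<^sub>-\<^sub>1] \<cdots> [a\<^sub>2\<inverse>, a\<^sub>1]\<close>.\<close>

definition surface_word :: "nat \<Rightarrow> (nat \<Rightarrow> 'i) \<Rightarrow> 'i word" where
  "surface_word g a =
     concat (map (\<lambda>m. wcomm (winv (gen (a (2*m)))) (gen (a (2*m - 1)))) (rev [1..<g + 1]))"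

definition braid_indices :: "nat \<Rightarrow> nat \<Rightarrow> (nat \<times> nat) set" where
  "braid_indices g n =
     {(i, j). 1 \<le> i \<and> i \<le> 2*g + n - 1 \<and> 2*g + 1 \<le> j \<and> j \<le> 2*g + n \<and> i < j}"

abbreviation Agen :: "nat \<Rightarrow> nat \<Rightarrow> (nat \<times> nat) word" where
  "Agen i j \<equiv> gen (i, j)"

abbreviation Ainv :: "nat \<Rightarrow> nat \<Rightarrow> (nat \<times> nat) word" where
  "Ainv i j \<equiv> winv (Agen i j)"

text \<open>The index conditions ensure that every generator occurring in a relation below is one of the
  generators in \<open>braid_indices g n\<close>.\<close>

definition PR1 :: "nat \<Rightarrow> nat \<Rightarrow> ((nat \<times> nat) word \<times> (nat \<times> nat) word) set" where
  "PR1 g n = {(Ainv i j @ Agen r s @ Agen i j, Agen r s) | i j r s.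
     (i, j) \<in> braid_indices g n \<and> (r, s) \<in> braid_indices g n \<and>
     (i < j \<and> j < r \<and> r < s \<or> r + 1 < i \<and> i < j \<and> j < s \<or>
      i = r + 1 \<and> r + 1 < j \<and> j < s \<and> (r \<ge> 2*g \<or> even r))}"

definition PR2 :: "nat \<Rightarrow> nat \<Rightarrow> ((nat \<times> nat) word \<times> (nat \<times> nat) word) set" where
  "PR2 g n = {(Ainv i j @ Agen j s @ Agen i j, Agen i s @ Agen j s @ Ainv i s) | i j s.
     (i, j) \<in> braid_indices g n \<and> (j, s) \<in> braid_indices g n \<and> i < j \<and> j < s}"

definition PR3 :: "nat \<Rightarrow> nat \<Rightarrow> ((nat \<times> nat) word \<times> (nat \<times> nat) word) set" where
  "PR3 g n = {(Ainv i j @ Agen i s @ Agen i j, Agen i s @ Agen j s @ Agen i s @ Ainv j s @ Ainv i s) | i j s.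
     (i, j) \<in> braid_indices g n \<and> (i, s) \<in> braid_indices g n \<and> i < j \<and> j < s}"

definition PR4 :: "nat \<Rightarrow> nat \<Rightarrow> ((nat \<times> nat) word \<times> (nat \<times> nat) word) set" where
  "PR4 g n = {(Ainv i j @ Agen r s @ Agen i j,
      Agen i s @ Agen j s @ Ainv i s @ Ainv j s @ Agen r s @ Agen j s @ Agen i s @ Ainv j s @ Ainv i s) | i j r s.
     (i, j) \<in> braid_indices g n \<and> (r, s) \<in> braid_indices g n \<and>
     (i + 1 < r \<and> r < j \<and> j < s \<or>
      i + 1 = r \<and> r < j \<and> j < s \<and> (r > 2*g \<or> odd r))}"

definition ER1 :: "nat \<Rightarrow> nat \<Rightarrow> ((nat \<times> nat) word \<times> (nat \<times> nat) word) set" where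
  "ER1 g n = {(Ainv (r + 1) j @ Agen r s @ Agen (r + 1) j, Agen r s @ Agen (r + 1) s @ Ainv j s @ Ainv (r + 1) s) | j r s.
     (r + 1, j) \<in> braid_indices g n \<and> (r, s) \<in> braid_indices g n \<and> odd r \<and> r < 2*g \<and> j < s}"

definition ER2 :: "nat \<Rightarrow> nat \<Rightarrow> ((nat \<times> nat) word \<times> (nat \<times> nat) word) set" where
  "ER2 g n = {(Ainv (r - 1) j @ Agen r s @ Agen (r - 1) j,
      Agen (r - 1) s @ Agen j s @ Ainv (r - 1) s @ Agen r s @ Agen j s @ Agen (r - 1) s @ Ainv j s @ Ainv (r - 1) s) | j r s.
     (r - 1, j) \<in> braid_indices g n \<and> (r, s) \<in> braid_indices g n \<and> even r \<and> r \<le> 2*g \<and> j < s}"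

definition TR :: "nat \<Rightarrow> nat \<Rightarrow> ((nat \<times> nat) word \<times> (nat \<times> nat) word) set" where
  "TR g n = {(surface_word g (\<lambda>i. (i, 2*g + k)),
      concat (map (\<lambda>l. Agen l (2*g + k)) [2*g + 1..<2*g + k]) @
      concat (map (\<lambda>j. Agen (2*g + k) j) [2*g + k + 1..<2*g + n + 1])) | k. 1 \<le> k \<and> k \<le> n}"

definition braid_relations :: "nat \<Rightarrow> nat \<Rightarrow> ((nat \<times> nat) word \<times> (nat \<times> nat) word) set" where
  "braid_relations g n =
     PR1 g n \<union> PR2 g n \<union> PR3 g n \<union> PR4 g n \<union> ER1 g n \<union> ER2 g n \<union> TR g n"

text \<open>The word \<open>B\<^sub>k = A\<^sub>2\<^sub>g\<^sub>,\<^sub>j\<^sub>k A\<^sub>j\<^sub>1\<^sub>,\<^sub>j\<^sub>k \<cdots>\<close>, with \<open>j\<^sub>t = 2g + t\<close> for \<open>1 \<le> t < k\<close>.\<close>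

definition Bword :: "nat \<Rightarrow> nat \<Rightarrow> (nat \<times> nat) word" where
  "Bword g k = Agen (2*g) (2*g + k) @ concat (map (\<lambda>t. Agen (2*g + t) (2*g + k)) [1..<k])"

end

theory Submission
  imports Defs
begin

text \<open>
  By von Dyck's theorem the prescribed values on generators extend to a homomorphism as soon as they
  satisfy the surface relator, and a homomorphism is a section as soon as it is one on generators.
  The latter is immediate: forgetting all strands but the first kills every letter of
  \<open>B\<^sub>1 \<cdots> B\<^sub>n\<close> except the first one.

  For the surface relator write \<open>a\<close> and \<open>b\<close> for the generators with indices \<open>2g - 1\<close> and \<open>2g\<close> of the
  first strand (so \<open>b = B\<^sub>1\<close>), \<open>c\<close> for the product of the remaining commutators of the surface word on
  the first strand, \<open>t\<^sub>k\<close> for the generator in which strand \<open>1\<close> and strand \<open>k\<close> run around each other,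
  \<open>t = t\<^sub>2 \<cdots> t\<^sub>n\<close> and \<open>B = B\<^sub>2 \<cdots> B\<^sub>n\<close>. Relation (TR) of the first strand says
  \<open>b\<inverse> a b a\<inverse> c = t\<close>, and what has to be shown is \<open>(b B)\<inverse> a (b B) a\<inverse> c = 1\<close>: replacing \<open>b\<close> by \<open>b B\<close>
  must absorb the obstruction \<open>t\<close>. The mechanism is the element \<open>D\<^sub>k = t\<^sub>k\<inverse> B\<^sub>k\<close>, for which
  three facts follow from the relations:
  \<^item> \<open>a B\<^sub>k = D\<^sub>k a\<close> (\<open>penultimate_generator_moves_B\<close>);
  \<^item> \<open>D\<^sub>k\<close> commutes with the generators of index below \<open>2g - 1\<close> of the first strand, hence with \<open>c\<close>
    (\<open>generator_commutes_D\<close>);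
  \<^item> \<open>D\<^sub>k\<close> commutes with \<open>t\<^sub>l\<close> for \<open>l > k\<close>, so that \<open>t D\<^sub>2 \<cdots> D\<^sub>n = (t\<^sub>2 D\<^sub>2) \<cdots> (t\<^sub>n D\<^sub>n) = B\<close>
    (\<open>D_commutes_T\<close>).

  With \<open>D = D\<^sub>2 \<cdots> D\<^sub>n\<close> and (TR) in the form \<open>a b a\<inverse> = b t c\<inverse>\<close> these give
  \<open>a (b B) a\<inverse> = (b t c\<inverse>) D = b (t D) c\<inverse> = b B c\<inverse>\<close>, which is the claim.
\<close>

section \<open>Fundamental groups and induced homomorphisms\<close>

text \<open>In an arbitrary space there are no linear paths, but the unit and inverse laws
  are still inherited from the real line: they hold for the identity path of the unit interval, and
  any path \<open>p\<close> is the image of that path under \<open>p\<close> itself.\<close>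

lemma homotopic_paths_group_laws:
  fixes p :: "real \<Rightarrow> 'a::topological_space"
  assumes "path p" "path_image p \<subseteq> X"
  shows "homotopic_paths X (p +++ (\<lambda>t. pathfinish p)) p"
    and "homotopic_paths X ((\<lambda>t. pathstart p) +++ p) p"
    and "homotopic_paths X (p +++ reversepath p) (\<lambda>t. pathstart p)"
proof -
  have image: "homotopic_paths X (p \<circ> u) (p \<circ> v)" if "homotopic_paths {0..1} u v" for u v
    by (rule homotopic_paths_continuous_image[OF that])
       (use assms in \<open>auto simp: path_def path_image_def\<close>)
  have id: "path (id :: real \<Rightarrow> real)" "path_image (id :: real \<Rightarrow> real) \<subseteq> {0..1}"
    by (auto simp: path_def path_image_def id_def)
  have ends: "pathstart (id :: real \<Rightarrow> real) = 0" "pathfinish (id :: real \<Rightarrow> real) = 1"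
    by (auto simp: pathstart_def pathfinish_def)
  have comp: "p \<circ> (u +++ v) = (p \<circ> u) +++ (p \<circ> v)" for u v
    by (auto simp: joinpaths_def)
  have const: "p \<circ> linepath a a = (\<lambda>t. p a)" for a
    by (simp add: linepath_def o_def algebra_simps)
  show "homotopic_paths X (p +++ (\<lambda>t. pathfinish p)) p"
    using image[OF homotopic_paths_rid[OF id]] by (simp add: comp const ends pathfinish_def)
  show "homotopic_paths X ((\<lambda>t. pathstart p) +++ p) p"
    using image[OF homotopic_paths_lid[OF id]] by (simp add: comp const ends pathstart_def)
  have "p \<circ> reversepath id = reversepath p"
    by (auto simp: reversepath_def)
  then show "homotopic_paths X (p +++ reversepath p) (\<lambda>t. pathstart p)"
    using image[OF homotopic_paths_rinv[OF id]] by (simp add: comp const ends pathstart_def)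
qed

lemma path_class_eq_iff:
  assumes "p \<in> loops X x"
  shows "path_class X p = path_class X q \<longleftrightarrow> homotopic_paths X p q"
proof
  assume "path_class X p = path_class X q"
  moreover have "p \<in> path_class X p"
    using assms by (simp add: path_class_def loops_def)
  ultimately show "homotopic_paths X p q"
    by (auto simp: path_class_def intro: homotopic_paths_sym)
next
  assume "homotopic_paths X p q"
  then show "path_class X p = path_class X q"
    by (auto simp: path_class_def intro: homotopic_paths_sym homotopic_paths_trans)
qed

text \<open>The product of two classes is defined through all their representatives; this
  lemma says that a single pair of representatives determines it.\<close>

lemma fundamental_group_mult:
  assumes "p \<in> loops X x" "q \<in> loops X x"
  shows "path_class X p \<otimes>\<^bsub>fundamental_group X x\<^esub> path_class X q = path_class X (p +++ q)"
proof -
  have "homotopic_paths X (p +++ q) r \<longleftrightarrow>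
      (\<exists>p'\<in>path_class X p. \<exists>q'\<in>path_class X q. homotopic_paths X (p' +++ q') r)" for r
  proof
    assume "homotopic_paths X (p +++ q) r"
    moreover have "p \<in> path_class X p" "q \<in> path_class X q"
      using assms by (auto simp: path_class_def loops_def)
    ultimately show "\<exists>p'\<in>path_class X p. \<exists>q'\<in>path_class X q. homotopic_paths X (p' +++ q') r"
      by blast
  next
    assume "\<exists>p'\<in>path_class X p. \<exists>q'\<in>path_class X q. homotopic_paths X (p' +++ q') r"
    then obtain p' q' where "homotopic_paths X p p'" "homotopic_paths X q q'"
        and r: "homotopic_paths X (p' +++ q') r"
      by (auto simp: path_class_def)
    then have "homotopic_paths X (p +++ q) (p' +++ q')"
      using assms by (intro homotopic_paths_join) (auto simp: loops_def)
    then show "homotopic_paths X (p +++ q) r"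
      using r homotopic_paths_trans by blast
  qed
  then show ?thesis
    by (auto simp: fundamental_group_def path_class_def)
qed

lemma loops_closed:
  assumes "p \<in> loops X x"
  shows "reversepath p \<in> loops X x"
    and "q \<in> loops X x \<Longrightarrow> p +++ q \<in> loops X x"
  using assms by (auto simp: loops_def path_image_join)

lemma group_fundamental_group:
  assumes "x \<in> X"
  shows "group (fundamental_group X x)"
proof -
  let ?G = "fundamental_group X x"
  have carrier: "carrier ?G = path_class X ` loops X x"
    by (simp add: fundamental_group_def)
  have one: "\<one>\<^bsub>?G\<^esub> = path_class X (\<lambda>t. x)"
    by (simp add: fundamental_group_def)
  have const: "(\<lambda>t. x) \<in> loops X x"
    using assms by (auto simp: loops_def path_def path_image_def pathstart_def pathfinish_def)
  note [simp] = carrier one fundamental_group_mult const loops_closed path_class_eq_iff[where x = x]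
  show ?thesis
  proof (rule groupI)
    show "\<one>\<^bsub>?G\<^esub> \<in> carrier ?G"
      using const by (simp only: carrier one imageI)
  next
    fix P Q assume "P \<in> carrier ?G" "Q \<in> carrier ?G"
    then show "P \<otimes>\<^bsub>?G\<^esub> Q \<in> carrier ?G"
      by auto
  next
    fix P Q R assume "P \<in> carrier ?G" "Q \<in> carrier ?G" "R \<in> carrier ?G"
    then obtain p q r where loops: "p \<in> loops X x" "q \<in> loops X x" "r \<in> loops X x"
        and classes: "P = path_class X p" "Q = path_class X q" "R = path_class X r"
      by auto
    have "homotopic_paths X ((p +++ q) +++ r) (p +++ (q +++ r))"
      using loops by (intro homotopic_paths_sym[OF homotopic_paths_assoc]) (auto simp: loops_def)
    then show "P \<otimes>\<^bsub>?G\<^esub> Q \<otimes>\<^bsub>?G\<^esub> R = P \<otimes>\<^bsub>?G\<^esub> (Q \<otimes>\<^bsub>?G\<^esub> R)"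
      using loops by (simp add: classes)
  next
    fix P assume "P \<in> carrier ?G"
    then obtain p where p: "p \<in> loops X x" "P = path_class X p"
      by auto
    then show "\<one>\<^bsub>?G\<^esub> \<otimes>\<^bsub>?G\<^esub> P = P"
      using homotopic_paths_group_laws(2)[of p X] p by (simp, simp add: loops_def)
    have "homotopic_paths X (reversepath p +++ p) (\<lambda>t. x)"
      using homotopic_paths_group_laws(3)[of "reversepath p" X] p by (auto simp: loops_def)
    then show "\<exists>Q\<in>carrier ?G. Q \<otimes>\<^bsub>?G\<^esub> P = \<one>\<^bsub>?G\<^esub>"
      using p by (intro bexI[of _ "path_class X (reversepath p)"]) (simp_all add: imageI)
  qed
qed

lemma fundamental_group_map_hom:
  assumes cont: "continuous_on X f" and maps: "f \<in> X \<rightarrow> Y"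
  shows "fundamental_group_map Y f \<in> hom (fundamental_group X x) (fundamental_group Y (f x))"
proof -
  have loop: "f \<circ> p \<in> loops Y (f x)" if "p \<in> loops X x" for p
    using that maps path_continuous_image[of p f] continuous_on_subset[OF cont]
    by (auto simp: loops_def pathstart_compose pathfinish_compose path_image_compose)
  have map: "fundamental_group_map Y f (path_class X p) = path_class Y (f \<circ> p)"
    if "p \<in> loops X x" for p
  proof -
    have "p \<in> path_class X p"
      using that by (simp add: path_class_def loops_def)
    moreover have "homotopic_paths Y (f \<circ> p) (f \<circ> q)" if "q \<in> path_class X p" for q
      using that by (auto simp: path_class_def intro: homotopic_paths_continuous_image[OF _ cont maps])
    ultimately show ?thesis
      by (auto simp: fundamental_group_map_def path_class_def[of Y] intro: homotopic_paths_trans)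
  qed
  have comp: "f \<circ> (p +++ q) = (f \<circ> p) +++ (f \<circ> q)" for p q :: "real \<Rightarrow> 'a"
    by (auto simp: joinpaths_def)
  show ?thesis
    by (rule homI)
       (auto simp: fundamental_group_def[THEN arg_cong[where f = carrier]] map loop
         fundamental_group_mult loops_closed comp)
qed

lemma forget_to_first_hom:
  assumes "n \<ge> 1"
  shows "forget_to_first S \<in> hom (pure_braid_group n S x) (fundamental_group S (x 1))"
  unfolding forget_to_first_def pure_braid_group_def
proof (rule fundamental_group_map_hom)
  show "continuous_on (configuration_space n S) (\<lambda>y. y 1)"
    by (rule continuous_on_subset[OF continuous_on_product_coordinates]) simp
  show "(\<lambda>y. y 1) \<in> configuration_space n S \<rightarrow> S"
    using assms by (auto simp: configuration_space_def PiE_iff)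
qed

section \<open>Von Dyck's theorem\<close>

lemma words_simps [simp]:
  "[] \<in> words I"
  "a # w \<in> words I \<longleftrightarrow> fst a \<in> I \<and> w \<in> words I"
  "u @ v \<in> words I \<longleftrightarrow> u \<in> words I \<and> v \<in> words I"
  by (cases a; auto simp: words_def)+

lemma concat_in_words: "(\<And>k. k \<in> set ks \<Longrightarrow> u k \<in> words I) \<Longrightarrow> concat (map u ks) \<in> words I"
  by (induction ks) auto

context group
begin

lemma eval_word_closed [simp, intro]:
  "w \<in> words I \<Longrightarrow> x \<in> I \<rightarrow> carrier G \<Longrightarrow> eval_word G x w \<in> carrier G"
  by (induction w) auto

lemma eval_word_append:
  "u \<in> words I \<Longrightarrow> v \<in> words I \<Longrightarrow> x \<in> I \<rightarrow> carrier G \<Longrightarrow>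
    eval_word G x (u @ v) = eval_word G x u \<otimes> eval_word G x v"
  by (induction u) (auto simp: m_assoc Pi_iff)

lemma eval_word_eq_one: "(\<And>a. a \<in> set w \<Longrightarrow> x (fst a) = \<one>) \<Longrightarrow> eval_word G x w = \<one>"
  by (induction w) auto

text \<open>A group that satisfies the relators identifies all words that the presentation
  identifies. This half of von Dyck's theorem is an induction over the derivation.\<close>

lemma presented_eq_sound:
  assumes eq: "presented_eq I R u v"
    and R: "R \<subseteq> words I \<times> words I"
    and x: "x \<in> I \<rightarrow> carrier G"
    and relators: "\<And>l r. (l, r) \<in> R \<Longrightarrow> eval_word G x l = eval_word G x r"
  shows "eval_word G x u = eval_word G x v"
  using eq
proof induction
  case (cancel u v i e)
  then have "x i \<in> carrier G" "eval_word G x v \<in> carrier G"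
    using x by auto
  then have "eval_word G x ([(i, e), (i, \<not> e)] @ v) = eval_word G x v"
    by (cases e) (simp_all flip: m_assoc)
  moreover have "[(i, e), (i, \<not> e)] @ v \<in> words I"
    using cancel by simp
  ultimately show ?case
    using cancel x by (simp only: eval_word_append[where I = I])
next
  case (relation u v l r)
  then have "l \<in> words I" "r \<in> words I"
    using R by auto
  then show ?case
    using relation x relators[of l r] by (simp add: eval_word_append[where I = I])
qed auto

end

lemma eval_word_hom:
  assumes "group G" "group H" "h \<in> hom G H" "w \<in> words I" "x \<in> I \<rightarrow> carrier G"
  shows "h (eval_word G x w) = eval_word H (\<lambda>i. h (x i)) w"
proof -
  interpret group_hom G H h
    using assms by (simp add: group_hom_def group_hom_axioms_def)
  show ?thesis
    using assms(4)
  proof (induction w)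
    case (Cons a w)
    then have "x (fst a) \<in> carrier G" "eval_word G x w \<in> carrier G"
      using assms(5) by auto
    then show ?case
      using Cons by auto
  qed auto
qed

text \<open>Von Dyck's theorem. An element of \<open>G\<close> is sent to the value in \<open>H\<close> of any word
  that represents it; the presentation of \<open>G\<close> relates any two such words by the relators, so the choice
  does not matter.\<close>

lemma von_Dyck:
  assumes G: "group G" and H: "group H"
    and pres: "has_presentation G x I R"
    and y: "y \<in> I \<rightarrow> carrier H"
    and relators: "\<And>l r. (l, r) \<in> R \<Longrightarrow> eval_word H y l = eval_word H y r"
  obtains s where "s \<in> hom G H"
    and "\<And>w. w \<in> words I \<Longrightarrow> s (eval_word G x w) = eval_word H y w"
proof -
  interpret G: group G by (rule G)
  interpret H: group H by (rule H)
  have R: "R \<subseteq> words I \<times> words I" and x: "x \<in> I \<rightarrow> carrier G"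
    and onto: "carrier G = eval_word G x ` words I"
    and inj: "\<And>u v. u \<in> words I \<Longrightarrow> v \<in> words I \<Longrightarrow>
        eval_word G x u = eval_word G x v \<Longrightarrow> presented_eq I R u v"
    using pres by (auto simp: has_presentation_def)
  define s where "s c = eval_word H y (SOME w. w \<in> words I \<and> eval_word G x w = c)" for c
  have s: "s (eval_word G x w) = eval_word H y w" if w: "w \<in> words I" for w
  proof -
    let ?v = "SOME v. v \<in> words I \<and> eval_word G x v = eval_word G x w"
    have "?v \<in> words I \<and> eval_word G x ?v = eval_word G x w"
      by (rule someI[of _ w]) (use w in simp)
    then have "presented_eq I R ?v w"
      using inj w by blast
    then have "eval_word H y ?v = eval_word H y w"
      using R y relators by (rule H.presented_eq_sound)
    then show ?thesis
      by (simp add: s_def)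
  qed
  have "s \<in> hom G H"
  proof (rule homI)
    show "s c \<in> carrier H" if "c \<in> carrier G" for c
      using that s y by (auto simp: onto)
    show "s (c \<otimes>\<^bsub>G\<^esub> d) = s c \<otimes>\<^bsub>H\<^esub> s d" if cd: "c \<in> carrier G" "d \<in> carrier G" for c d
    proof -
      obtain u v where uv: "u \<in> words I" "v \<in> words I" "c = eval_word G x u" "d = eval_word G x v"
        using cd by (auto simp: onto)
      have "c \<otimes>\<^bsub>G\<^esub> d = eval_word G x (u @ v)"
        unfolding uv(3,4) by (rule G.eval_word_append[OF uv(1,2) x, symmetric])
      then have "s (c \<otimes>\<^bsub>G\<^esub> d) = eval_word H y (u @ v)"
        using s[of "u @ v"] uv(1,2) by simp
      also have "\<dots> = s c \<otimes>\<^bsub>H\<^esub> s d"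
        unfolding uv(3,4) s[OF uv(1)] s[OF uv(2)] by (rule H.eval_word_append[OF uv(1,2) y])
      finally show ?thesis .
    qed
  qed
  then show ?thesis
    using s that by blast
qed

lemma has_presentation_relators:
  assumes "has_presentation G x I R" "(l, r) \<in> R"
  shows "eval_word G x l = eval_word G x r"
proof -
  have "presented_eq I R ([] @ l @ []) ([] @ r @ [])"
    using assms by (intro presented_eq.relation) auto
  then show ?thesis
    using assms by (auto simp: has_presentation_def)
qed

section \<open>Conjugation and products in groups\<close>

context group
begin

lemma cancel_left:
  "\<lbrakk>a \<in> carrier G; u \<in> carrier G\<rbrakk> \<Longrightarrow> a \<otimes> (inv a \<otimes> u) = u"
  "\<lbrakk>a \<in> carrier G; u \<in> carrier G\<rbrakk> \<Longrightarrow> inv a \<otimes> (a \<otimes> u) = u"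
  by (simp_all flip: m_assoc)

lemmas free_reduce = m_assoc inv_mult_group cancel_left

text \<open>This is the side on which the relations of the pure braid group are written, so each of them
  reads as the value of \<open>conj_by (A (i, j))\<close> on a generator.\<close>

definition conj_by :: "'a \<Rightarrow> 'a \<Rightarrow> 'a" where
  "conj_by a w = inv a \<otimes> w \<otimes> a"

lemma conj_by_mult:
  "\<lbrakk>a \<in> carrier G; u \<in> carrier G; v \<in> carrier G\<rbrakk> \<Longrightarrow> conj_by a (u \<otimes> v) = conj_by a u \<otimes> conj_by a v"
  by (simp add: conj_by_def free_reduce)

lemma conj_by_inv:
  "\<lbrakk>a \<in> carrier G; u \<in> carrier G\<rbrakk> \<Longrightarrow> conj_by a (inv u) = inv (conj_by a u)"
  by (simp add: conj_by_def m_assoc inv_mult_group)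

lemma conj_by_conj_by:
  "\<lbrakk>a \<in> carrier G; b \<in> carrier G; u \<in> carrier G\<rbrakk> \<Longrightarrow> conj_by b (conj_by a u) = conj_by (a \<otimes> b) u"
  by (simp add: conj_by_def m_assoc inv_mult_group)

lemma conj_by_fixed_iff:
  "\<lbrakk>a \<in> carrier G; u \<in> carrier G\<rbrakk> \<Longrightarrow> conj_by a u = u \<longleftrightarrow> a \<otimes> u = u \<otimes> a"
  using inv_solve_left'[of u a "u \<otimes> a"] by (auto simp: conj_by_def m_assoc)

text \<open>The elements play the roles \<open>a = A\<^sub>2\<^sub>g\<^sub>-\<^sub>1\<^sub>,\<^sub>j\<close>, \<open>\<alpha> = A\<^sub>2\<^sub>g\<^sub>-\<^sub>1\<^sub>,\<^sub>s\<close>, \<open>\<beta> = A\<^sub>2\<^sub>g\<^sub>,\<^sub>s\<close>,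
  \<open>\<tau> = A\<^sub>j\<^sub>,\<^sub>s\<close>, and \<open>\<beta> \<tau> v\<close> is \<open>B\<^sub>k\<close>. The prefix \<open>\<alpha> \<tau> \<alpha>\<inverse>\<close> that (ER2) puts in front of \<open>\<beta>\<close> is the conjugate
  of \<open>\<tau>\<close>, while its suffix and the conjugate of the second factor multiply to \<open>\<tau>\<close>.\<close>

lemma moves_past_ER2_action:
  assumes [simp]: "a \<in> carrier G" "\<alpha> \<in> carrier G" "\<beta> \<in> carrier G" "\<tau> \<in> carrier G" "v \<in> carrier G"
    and \<beta>: "conj_by a \<beta> = \<alpha> \<otimes> \<tau> \<otimes> inv \<alpha> \<otimes> \<beta> \<otimes> \<tau> \<otimes> \<alpha> \<otimes> inv \<tau> \<otimes> inv \<alpha>"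
    and \<tau>: "conj_by a \<tau> = \<alpha> \<otimes> \<tau> \<otimes> inv \<alpha>"
    and v: "conj_by a v = v"
  shows "a \<otimes> (\<beta> \<otimes> \<tau> \<otimes> v) = (inv \<tau> \<otimes> (\<beta> \<otimes> \<tau> \<otimes> v)) \<otimes> a"
proof -
  have "conj_by a (\<beta> \<otimes> \<tau> \<otimes> v) = conj_by a \<tau> \<otimes> (\<beta> \<otimes> \<tau> \<otimes> v)"
    by (simp add: conj_by_mult \<beta> \<tau> v free_reduce)
  then have "\<tau> \<otimes> (a \<otimes> (\<beta> \<otimes> \<tau> \<otimes> v)) = \<beta> \<otimes> \<tau> \<otimes> v \<otimes> a"
    by (simp add: conj_by_def m_assoc)
  then have "inv \<tau> \<otimes> (\<tau> \<otimes> (a \<otimes> (\<beta> \<otimes> \<tau> \<otimes> v))) = inv \<tau> \<otimes> (\<beta> \<otimes> \<tau> \<otimes> v \<otimes> a)"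
    by simp
  then show ?thesis
    by (simp add: free_reduce)
qed

text \<open>Here \<open>a = A\<^sub>i\<^sub>,\<^sub>j\<close> and \<open>\<alpha> = A\<^sub>i\<^sub>,\<^sub>s\<close> with \<open>i < 2g - 1\<close>. Conjugation multiplies \<open>\<beta> \<tau> v\<close>
  on the left by \<open>[\<alpha>, \<tau>] = \<alpha> \<tau> \<alpha>\<inverse> \<tau>\<inverse>\<close>, and it multiplies \<open>\<tau>\<close> by the same factor, so the quotient is
  fixed.\<close>

lemma fixed_by_PR4_action:
  assumes [simp]: "a \<in> carrier G" "\<alpha> \<in> carrier G" "\<beta> \<in> carrier G" "\<tau> \<in> carrier G" "v \<in> carrier G"
    and \<beta>: "conj_by a \<beta> = \<alpha> \<otimes> \<tau> \<otimes> inv \<alpha> \<otimes> inv \<tau> \<otimes> \<beta> \<otimes> \<tau> \<otimes> \<alpha> \<otimes> inv \<tau> \<otimes> inv \<alpha>"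
    and \<tau>: "conj_by a \<tau> = \<alpha> \<otimes> \<tau> \<otimes> inv \<alpha>"
    and v: "conj_by a v = v"
  shows "conj_by a (inv \<tau> \<otimes> (\<beta> \<otimes> \<tau> \<otimes> v)) = inv \<tau> \<otimes> (\<beta> \<otimes> \<tau> \<otimes> v)"
  by (simp add: conj_by_mult conj_by_inv \<beta> \<tau> v free_reduce)

text \<open>The roles are, for \<open>k < l\<close>, \<open>\<tau> = t\<^sub>k\<close>, \<open>b = A\<^sub>2\<^sub>g\<^sub>,\<^sub>j\<^sub>k\<close>, \<open>p = t\<^sub>l\<close>, \<open>q = A\<^sub>j\<^sub>k\<^sub>,\<^sub>j\<^sub>l\<close> and
  \<open>\<beta> = A\<^sub>2\<^sub>g\<^sub>,\<^sub>j\<^sub>l\<close>. Conjugating \<open>p\<close> by \<open>\<tau>\<inverse>\<close> gives \<open>q\<inverse> p q\<close>, an element that \<open>b\<close> centralizes although it moves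
  both \<open>p\<close> and \<open>q\<close>; conjugating by \<open>\<tau>\<close> then returns to \<open>p\<close>.\<close>

lemma fixes_later_strand:
  assumes [simp]: "\<tau> \<in> carrier G" "b \<in> carrier G" "v \<in> carrier G"
      "p \<in> carrier G" "q \<in> carrier G" "\<beta> \<in> carrier G"
    and "conj_by \<tau> p = p \<otimes> q \<otimes> p \<otimes> inv q \<otimes> inv p"
    and "conj_by \<tau> q = p \<otimes> q \<otimes> inv p"
    and "conj_by b p = \<beta> \<otimes> q \<otimes> inv \<beta> \<otimes> inv q \<otimes> p \<otimes> q \<otimes> \<beta> \<otimes> inv q \<otimes> inv \<beta>"
    and "conj_by b q = \<beta> \<otimes> q \<otimes> inv \<beta>"
    and "conj_by v p = p"
  shows "conj_by (inv \<tau> \<otimes> (b \<otimes> \<tau> \<otimes> v)) p = p"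
proof -
  have 1: "conj_by \<tau> (inv q \<otimes> p \<otimes> q) = p"
    by (simp add: assms conj_by_mult conj_by_inv free_reduce)
  have "conj_by (inv \<tau>) (conj_by \<tau> (inv q \<otimes> p \<otimes> q)) = inv q \<otimes> p \<otimes> q"
    by (simp add: conj_by_conj_by) (simp add: conj_by_def m_assoc)
  then have 2: "conj_by (inv \<tau>) p = inv q \<otimes> p \<otimes> q"
    by (simp only: 1)
  have 3: "conj_by b (inv q \<otimes> p \<otimes> q) = inv q \<otimes> p \<otimes> q"
    by (simp add: assms conj_by_mult conj_by_inv free_reduce)
  have "conj_by (inv \<tau> \<otimes> (b \<otimes> \<tau> \<otimes> v)) p = conj_by v (conj_by \<tau> (conj_by b (conj_by (inv \<tau>) p)))"
    by (simp add: conj_by_conj_by m_assoc)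
  also have "\<dots> = p"
    using 1 2 3 assms by simp
  finally show ?thesis .
qed

text \<open>The concluding computation, in the notation of the introduction: moving \<open>B\<close>
  past \<open>a\<inverse>\<close> and then past \<open>c\<close> turns it into \<open>D\<close>, which stands to the right of the relator that equals
  \<open>t\<close>.\<close>

lemma surface_relation_transfer:
  assumes [simp]: "a \<in> carrier G" "b \<in> carrier G" "c \<in> carrier G" "t \<in> carrier G"
      "B \<in> carrier G" "D \<in> carrier G"
    and rel: "inv b \<otimes> a \<otimes> b \<otimes> inv a \<otimes> c = t"
    and tD: "t \<otimes> D = B"
    and aB: "a \<otimes> B = D \<otimes> a"
    and cD: "c \<otimes> D = D \<otimes> c"
  shows "inv (b \<otimes> B) \<otimes> a \<otimes> (b \<otimes> B) \<otimes> inv a \<otimes> c = \<one>"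
proof -
  have "inv a \<otimes> (a \<otimes> B) \<otimes> inv a \<otimes> c = inv a \<otimes> (D \<otimes> a) \<otimes> inv a \<otimes> c"
    by (simp only: aB)
  then have B: "B \<otimes> (inv a \<otimes> c) = inv a \<otimes> (c \<otimes> D)"
    by (simp add: free_reduce cD)
  have "inv (b \<otimes> B) \<otimes> a \<otimes> (b \<otimes> B) \<otimes> inv a \<otimes> c =
      inv B \<otimes> (inv b \<otimes> a \<otimes> b \<otimes> inv a \<otimes> c) \<otimes> D"
    by (simp add: free_reduce B)
  also have "\<dots> = inv B \<otimes> (t \<otimes> D)"
    by (simp only: rel) (simp add: m_assoc)
  also have "\<dots> = \<one>"
    by (simp add: tD)
  finally show ?thesis .
qed

text \<open>With \<open>u = v\<close> this is commutation with a product; the two families are allowed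
  to differ because moving \<open>a\<close> past the elements \<open>B\<^sub>k\<close> changes them into \<open>D\<^sub>k\<close>.\<close>

lemma eval_word_concat_intertwine:
  assumes "\<And>k. k \<in> set ks \<Longrightarrow> u k \<in> words I" "\<And>k. k \<in> set ks \<Longrightarrow> v k \<in> words I"
    and "x \<in> I \<rightarrow> carrier G" "c \<in> carrier G"
    and "\<And>k. k \<in> set ks \<Longrightarrow> c \<otimes> eval_word G x (u k) = eval_word G x (v k) \<otimes> c"
  shows "c \<otimes> eval_word G x (concat (map u ks)) = eval_word G x (concat (map v ks)) \<otimes> c"
  using assms(1,2,5)
proof (induction ks)
  case (Cons k ks)
  let ?e = "eval_word G x"
  have w: "u k \<in> words I" "concat (map u ks) \<in> words I" "v k \<in> words I" "concat (map v ks) \<in> words I"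
    using Cons.prems by (auto intro!: concat_in_words)
  then have [simp]: "?e (u k) \<in> carrier G" "?e (concat (map u ks)) \<in> carrier G"
      "?e (v k) \<in> carrier G" "?e (concat (map v ks)) \<in> carrier G"
    using assms(3) by auto
  have "c \<otimes> (?e (u k) \<otimes> ?e (concat (map u ks))) = ?e (v k) \<otimes> (c \<otimes> ?e (concat (map u ks)))"
    using Cons.prems(3)[of k] assms(4) by (simp flip: m_assoc)
  also have "\<dots> = ?e (v k) \<otimes> ?e (concat (map v ks)) \<otimes> c"
    using Cons assms(4) by (simp add: m_assoc)
  finally show ?case
    using w assms(3) by (simp add: eval_word_append[where I = I])
qed (use assms(4) in auto)

text \<open>Interleaving the factors of two products only moves each \<open>v k\<close> to the left, past
  those \<open>u l\<close> that come later in the list; hence commutation is needed in one order only.\<close>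

lemma eval_word_concat_merge:
  assumes "\<And>k. k \<in> set ks \<Longrightarrow> u k \<in> words I" "\<And>k. k \<in> set ks \<Longrightarrow> v k \<in> words I"
    and "\<And>k. k \<in> set ks \<Longrightarrow> w k \<in> words I" and x: "x \<in> I \<rightarrow> carrier G"
    and "\<And>k. k \<in> set ks \<Longrightarrow> eval_word G x (u k) \<otimes> eval_word G x (v k) = eval_word G x (w k)"
    and "sorted_wrt (\<lambda>k l. eval_word G x (v k) \<otimes> eval_word G x (u l) =
           eval_word G x (u l) \<otimes> eval_word G x (v k)) ks"
  shows "eval_word G x (concat (map u ks)) \<otimes> eval_word G x (concat (map v ks)) =
    eval_word G x (concat (map w ks))"
  using assms(1,2,3,5,6)
proof (induction ks)
  case (Cons k ks)
  let ?e = "eval_word G x"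
  let ?us = "concat (map u ks)" and ?vs = "concat (map v ks)" and ?ws = "concat (map w ks)"
  have words: "u k \<in> words I" "v k \<in> words I" "w k \<in> words I"
      "?us \<in> words I" "?vs \<in> words I" "?ws \<in> words I"
    using Cons.prems(1-3) by (auto intro!: concat_in_words)
  have comm: "?e (v k) \<otimes> ?e ?us = ?e ?us \<otimes> ?e (v k)"
    using Cons.prems words x by (intro eval_word_concat_intertwine[where I = I]) auto
  have [simp]: "?e (u k) \<in> carrier G" "?e (v k) \<in> carrier G" "?e ?us \<in> carrier G" "?e ?vs \<in> carrier G"
    using words x by auto
  have "?e (u k) \<otimes> ?e ?us \<otimes> (?e (v k) \<otimes> ?e ?vs) = ?e (u k) \<otimes> (?e ?us \<otimes> ?e (v k)) \<otimes> ?e ?vs"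
    by (simp add: m_assoc)
  also have "\<dots> = ?e (u k) \<otimes> ?e (v k) \<otimes> (?e ?us \<otimes> ?e ?vs)"
    by (simp add: comm[symmetric] m_assoc)
  also have "\<dots> = ?e (w k) \<otimes> ?e ?ws"
    using Cons by simp
  finally show ?case
    using words x by (simp add: eval_word_append[where I = I])
qed auto

end

section \<open>Surface words\<close>

lemma surface_word_0 [simp]: "surface_word 0 a = []"
  by (simp add: surface_word_def)

text \<open>The commutators are listed by decreasing index, so the one of the last handle is
  split off at the front. The indices are written with \<open>Suc\<close> to agree with simplifier normal
  forms.\<close>

lemma surface_word_Suc:
  "surface_word (Suc h) a =
     [(a (Suc (Suc (2 * h))), False), (a (Suc (2 * h)), True),
      (a (Suc (Suc (2 * h))), True), (a (Suc (2 * h)), False)] @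
     surface_word h a"
  by (simp add: surface_word_def wcomm_def winv_def gen_def)

lemma surface_word_last:
  "h \<ge> 1 \<Longrightarrow> surface_word h a =
     [(a (2 * h), False), (a (2 * h - 1), True), (a (2 * h), True), (a (2 * h - 1), False)] @
     surface_word (h - 1) a"
  using surface_word_Suc[of "h - 1" a] by (cases h) auto

lemma eval_surface_word_cong:
  "(\<And>i. i \<in> {1..2 * h} \<Longrightarrow> x (a i) = y (b i)) \<Longrightarrow>
    eval_word G x (surface_word h a) = eval_word G y (surface_word h b)"
  by (induction h) (auto simp: surface_word_Suc)

lemma (in group) commute_surface_word:
  assumes "c \<in> carrier G" "\<And>i. i \<in> {1..2 * h} \<Longrightarrow> x (a i) \<in> carrier G"
    and "\<And>i. i \<in> {1..2 * h} \<Longrightarrow> x (a i) \<otimes> c = c \<otimes> x (a i)"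
  shows "eval_word G x (surface_word h a) \<in> carrier G \<and>
    eval_word G x (surface_word h a) \<otimes> c = c \<otimes> eval_word G x (surface_word h a)"
  using assms(2,3)
proof (induction h)
  case (Suc h)
  let ?e = "eval_word G x (surface_word h a)" and ?p = "x (a (Suc (Suc (2 * h))))" and ?q = "x (a (Suc (2 * h)))"
  have IH: "?e \<in> carrier G" "?e \<otimes> c = c \<otimes> ?e"
    using Suc by auto
  have [simp]: "?p \<in> carrier G" "?q \<in> carrier G" "c \<in> carrier G" "?e \<in> carrier G"
    using Suc.prems(1) assms(1) IH by auto
  have "conj_by c ?p = ?p" "conj_by c ?q = ?q" "conj_by c ?e = ?e"
    using Suc.prems(2)[of "Suc (Suc (2 * h))"] Suc.prems(2)[of "Suc (2 * h)"] IH
    by (simp_all add: conj_by_fixed_iff)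
  then have "conj_by c (inv ?p \<otimes> (?q \<otimes> (?p \<otimes> (inv ?q \<otimes> ?e)))) = inv ?p \<otimes> (?q \<otimes> (?p \<otimes> (inv ?q \<otimes> ?e)))"
    by (simp add: conj_by_mult conj_by_inv)
  then show ?case
    by (simp add: surface_word_Suc conj_by_fixed_iff)
qed (use assms(1) in auto)

section \<open>Consequences of the pure braid relations\<close>

text \<open>The computations below take place in any group with a family of elements satisfying the
  relations of the pure braid group.\<close>

locale surface_braid_relators = group G
  for G :: "('a, 'b) monoid_scheme" (structure) +
  fixes A :: "nat \<times> nat \<Rightarrow> 'a" and g n :: nat
  assumes genus: "g \<ge> 1" and strands: "n \<ge> 1"
    and generators: "A \<in> braid_indices g n \<rightarrow> carrier G"
    and relators: "(l, r) \<in> braid_relations g n \<Longrightarrow> eval_word G A l = eval_word G A r"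
begin

lemma braid_index: "\<lbrakk>1 \<le> i; i < j; 2*g < j; j \<le> 2*g + n\<rbrakk> \<Longrightarrow> (i, j) \<in> braid_indices g n"
  by (auto simp: braid_indices_def)

lemma A_closed [simp]: "\<lbrakk>1 \<le> i; i < j; 2*g < j; j \<le> 2*g + n\<rbrakk> \<Longrightarrow> A (i, j) \<in> carrier G"
  using generators braid_index by (auto simp: Pi_iff)

lemmas relator_simps = gen_def winv_def conj_by_def m_assoc

lemma conj_by_PR1:
  assumes "1 \<le> i" "i < j" "1 \<le> r" "r < s" "2*g < j" "2*g < s" "s \<le> 2*g + n" "j \<le> 2*g + n"
    and "j < r \<or> i = r + 1 \<and> j < s \<and> r \<ge> 2*g \<or> r + 1 < i \<and> j < s"
  shows "conj_by (A (i, j)) (A (r, s)) = A (r, s)"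
proof -
  have "(Ainv i j @ Agen r s @ Agen i j, Agen r s) \<in> PR1 g n"
    using assms braid_index[of i j] braid_index[of r s] by (auto simp: PR1_def)
  then show ?thesis
    using relators[of "Ainv i j @ Agen r s @ Agen i j" "Agen r s"] assms
    by (simp add: braid_relations_def relator_simps)
qed

lemma conj_by_PR2:
  assumes "1 \<le> i" "i < j" "j < s" "2*g < j" "s \<le> 2*g + n"
  shows "conj_by (A (i, j)) (A (j, s)) = A (i, s) \<otimes> A (j, s) \<otimes> inv A (i, s)"
proof -
  have "(Ainv i j @ Agen j s @ Agen i j, Agen i s @ Agen j s @ Ainv i s) \<in> PR2 g n"
    using assms braid_index[of i j] braid_index[of j s] by (auto simp: PR2_def)
  then show ?thesis
    using relators[of "Ainv i j @ Agen j s @ Agen i j" "Agen i s @ Agen j s @ Ainv i s"] assms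
    by (simp add: braid_relations_def relator_simps)
qed

lemma conj_by_PR3:
  assumes "1 \<le> i" "i < j" "j < s" "2*g < j" "s \<le> 2*g + n"
  shows "conj_by (A (i, j)) (A (i, s)) =
    A (i, s) \<otimes> A (j, s) \<otimes> A (i, s) \<otimes> inv A (j, s) \<otimes> inv A (i, s)"
proof -
  let ?l = "Ainv i j @ Agen i s @ Agen i j" and ?r = "Agen i s @ Agen j s @ Agen i s @ Ainv j s @ Ainv i s"
  have "(?l, ?r) \<in> PR3 g n"
    using assms braid_index[of i j] braid_index[of i s] by (auto simp: PR3_def)
  then show ?thesis
    using relators[of ?l ?r] assms by (simp add: braid_relations_def relator_simps)
qed

lemma conj_by_PR4:
  assumes "1 \<le> i" "r < j" "j < s" "2*g < j" "s \<le> 2*g + n"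
    and "i + 1 < r \<or> i + 1 = r \<and> r > 2*g"
  shows "conj_by (A (i, j)) (A (r, s)) = A (i, s) \<otimes> A (j, s) \<otimes> inv A (i, s) \<otimes> inv A (j, s) \<otimes>
    A (r, s) \<otimes> A (j, s) \<otimes> A (i, s) \<otimes> inv A (j, s) \<otimes> inv A (i, s)"
proof -
  let ?l = "Ainv i j @ Agen r s @ Agen i j"
    and ?r = "Agen i s @ Agen j s @ Ainv i s @ Ainv j s @ Agen r s @ Agen j s @ Agen i s @ Ainv j s @ Ainv i s"
  have less: "1 \<le> r" "r < s" "i < j"
    using assms by auto
  have "(?l, ?r) \<in> PR4 g n"
    unfolding PR4_def
    by (rule CollectI, rule exI[of _ i], rule exI[of _ j], rule exI[of _ r], rule exI[of _ s])
       (use assms less braid_index[of i j] braid_index[of r s] in auto)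
  then show ?thesis
    using relators[of ?l ?r] assms less by (simp add: braid_relations_def relator_simps)
qed

lemma conj_by_ER2:
  assumes "even r" "2 \<le> r" "r \<le> 2*g" "2*g < j" "j < s" "s \<le> 2*g + n"
  shows "conj_by (A (r - 1, j)) (A (r, s)) = A (r - 1, s) \<otimes> A (j, s) \<otimes> inv A (r - 1, s) \<otimes>
    A (r, s) \<otimes> A (j, s) \<otimes> A (r - 1, s) \<otimes> inv A (j, s) \<otimes> inv A (r - 1, s)"
proof -
  let ?l = "Ainv (r - 1) j @ Agen r s @ Agen (r - 1) j"
    and ?r = "Agen (r - 1) s @ Agen j s @ Ainv (r - 1) s @ Agen r s @ Agen j s @ Agen (r - 1) s @
      Ainv j s @ Ainv (r - 1) s"
  have "(?l, ?r) \<in> ER2 g n"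
    unfolding ER2_def
    by (rule CollectI, rule exI[of _ j], rule exI[of _ r], rule exI[of _ s])
       (use assms in \<open>auto intro!: braid_index\<close>)
  then show ?thesis
    using relators[of ?l ?r] assms by (simp add: braid_relations_def relator_simps)
qed

abbreviation ev :: "(nat \<times> nat) word \<Rightarrow> 'a" where
  "ev \<equiv> eval_word G A"

text \<open>In the notation of the introduction, \<open>T k\<close> represents \<open>t\<^sub>k\<close> and \<open>D k\<close> represents \<open>D\<^sub>k\<close>. For \<open>k > 1\<close>
  the word \<open>V k\<close> is the part of \<open>B\<^sub>k\<close> that does not involve the first strand or the handles:
  \<open>B\<^sub>k = A\<^sub>2\<^sub>g\<^sub>,\<^sub>j\<^sub>k t\<^sub>k V\<^sub>k\<close>.\<close>

abbreviation T :: "nat \<Rightarrow> (nat \<times> nat) word" where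
  "T k \<equiv> Agen (2*g + 1) (2*g + k)"

definition V :: "nat \<Rightarrow> (nat \<times> nat) word" where
  "V k = concat (map (\<lambda>t. Agen (2*g + t) (2*g + k)) [2..<k])"

definition D :: "nat \<Rightarrow> (nat \<times> nat) word" where
  "D k = winv (T k) @ Bword g k"

lemma gen_in_words: "gen i \<in> words I \<longleftrightarrow> i \<in> I" "winv (gen i) \<in> words I \<longleftrightarrow> i \<in> I"
  by (auto simp: gen_def winv_def)

lemma in_words:
  assumes "1 < k" "k \<le> n"
  shows "T k \<in> words (braid_indices g n)" "Bword g k \<in> words (braid_indices g n)"
    "V k \<in> words (braid_indices g n)" "D k \<in> words (braid_indices g n)"
  using assms genus braid_index
  by (auto simp: D_def Bword_def V_def gen_in_words intro!: concat_in_words)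

lemma ev_T: "\<lbrakk>1 < k; k \<le> n\<rbrakk> \<Longrightarrow> ev (T k) = A (2*g + 1, 2*g + k)"
  by (simp add: gen_def)

lemma ev_B:
  assumes "1 < k" "k \<le> n"
  shows "ev (Bword g k) = A (2*g, 2*g + k) \<otimes> A (2*g + 1, 2*g + k) \<otimes> ev (V k)"
proof -
  have "[1..<k] = 1 # [2..<k]"
    using assms by (simp add: upt_conv_Cons numeral_2_eq_2)
  then have "Bword g k = [((2*g, 2*g + k), True), ((2*g + 1, 2*g + k), True)] @ V k"
    by (simp add: Bword_def V_def gen_def)
  moreover have "ev (V k) \<in> carrier G"
    using in_words(3)[OF assms] generators by blast
  ultimately show ?thesis
    using assms genus by (simp add: m_assoc)
qed

lemma ev_D:
  assumes "1 < k" "k \<le> n"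
  shows "ev (D k) = inv A (2*g + 1, 2*g + k) \<otimes> (A (2*g, 2*g + k) \<otimes> A (2*g + 1, 2*g + k) \<otimes> ev (V k))"
  unfolding ev_B[OF assms, symmetric] by (simp add: D_def gen_def winv_def)

lemma V_closed: "\<lbrakk>1 < k; k \<le> n\<rbrakk> \<Longrightarrow> ev (V k) \<in> carrier G"
  using in_words(3) generators by blast

lemma commute_V:
  assumes "1 < k" "k \<le> n" "c \<in> carrier G"
    and "\<And>t. \<lbrakk>1 < t; t < k\<rbrakk> \<Longrightarrow> c \<otimes> A (2*g + t, 2*g + k) = A (2*g + t, 2*g + k) \<otimes> c"
  shows "c \<otimes> ev (V k) = ev (V k) \<otimes> c"
  unfolding V_def
  by (rule eval_word_concat_intertwine[OF _ _ generators])
     (use assms braid_index in \<open>auto simp: gen_def\<close>)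

text \<open>\<open>A\<^sub>2\<^sub>g\<^sub>-\<^sub>1\<^sub>,\<^sub>j\<^sub>1\<close> acts on \<open>A\<^sub>2\<^sub>g\<^sub>,\<^sub>j\<^sub>k\<close> by (ER2), on \<open>t\<^sub>k\<close> by (PR2), and trivially on \<open>V\<^sub>k\<close> by (PR1).\<close>

lemma penultimate_generator_moves_B:
  assumes k: "1 < k" "k \<le> n"
  shows "A (2*g - 1, 2*g + 1) \<otimes> ev (Bword g k) = ev (D k) \<otimes> A (2*g - 1, 2*g + 1)"
  unfolding ev_B[OF k] ev_D[OF k]
proof (rule moves_past_ER2_action[where \<alpha> = "A (2*g - 1, 2*g + k)"])
  have "A (2*g - 1, 2*g + 1) \<otimes> ev (V k) = ev (V k) \<otimes> A (2*g - 1, 2*g + 1)"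
  proof (rule commute_V[OF k])
    fix t assume "1 < t" "t < k"
    then show "A (2*g - 1, 2*g + 1) \<otimes> A (2*g + t, 2*g + k) = A (2*g + t, 2*g + k) \<otimes> A (2*g - 1, 2*g + 1)"
      using conj_by_PR1[of "2*g - 1" "2*g + 1" "2*g + t" "2*g + k"] genus k by (simp add: conj_by_fixed_iff)
  qed (use genus k in simp)
  then show "conj_by (A (2*g - 1, 2*g + 1)) (ev (V k)) = ev (V k)"
    using genus k V_closed by (simp add: conj_by_fixed_iff)
qed (use genus k V_closed conj_by_PR2[of "2*g - 1" "2*g + 1" "2*g + k"] conj_by_ER2[of "2*g" "2*g + 1" "2*g + k"] in auto)

text \<open>For the handles before the last one the action on \<open>A\<^sub>2\<^sub>g\<^sub>,\<^sub>j\<^sub>k\<close> is given by (PR4) instead of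
  (ER2), and the resulting factor of \<open>B\<^sub>k\<close> is the one by which \<open>t\<^sub>k\<close> changes.\<close>

lemma generator_commutes_D:
  assumes k: "1 < k" "k \<le> n" and i: "1 \<le> i" "i < 2*g - 1"
  shows "A (i, 2*g + 1) \<otimes> ev (D k) = ev (D k) \<otimes> A (i, 2*g + 1)"
proof -
  have "A (i, 2*g + 1) \<otimes> ev (V k) = ev (V k) \<otimes> A (i, 2*g + 1)"
  proof (rule commute_V[OF k])
    fix t assume "1 < t" "t < k"
    then show "A (i, 2*g + 1) \<otimes> A (2*g + t, 2*g + k) = A (2*g + t, 2*g + k) \<otimes> A (i, 2*g + 1)"
      using conj_by_PR1[of i "2*g + 1" "2*g + t" "2*g + k"] i k by (simp add: conj_by_fixed_iff)
  qed (use i k in simp)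
  then have "conj_by (A (i, 2*g + 1)) (ev (V k)) = ev (V k)"
    using i k V_closed by (simp add: conj_by_fixed_iff)
  then have "conj_by (A (i, 2*g + 1)) (ev (D k)) = ev (D k)"
    unfolding ev_D[OF k]
    by (intro fixed_by_PR4_action[where \<alpha> = "A (i, 2*g + k)"])
       (use i k V_closed conj_by_PR2[of i "2*g + 1" "2*g + k"] conj_by_PR4[of i "2*g" "2*g + 1" "2*g + k"] in auto)
  then show ?thesis
    using i k in_words(4)[OF k] generators by (simp add: conj_by_fixed_iff eval_word_closed)
qed

text \<open>The factor \<open>V\<^sub>k\<close> of \<open>D\<^sub>k\<close> commutes with \<open>t\<^sub>l\<close> by (PR1). The relations move \<open>t\<^sub>l\<close> under conjugation by the
  factors \<open>t\<^sub>k\<close> and \<open>A\<^sub>2\<^sub>g\<^sub>,\<^sub>j\<^sub>k\<close>, and only the combined effect of these factors is trivial.\<close>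

lemma D_commutes_T:
  assumes k: "1 < k" "k < l" and l: "l \<le> n"
  shows "ev (D k) \<otimes> ev (T l) = ev (T l) \<otimes> ev (D k)"
proof -
  have k': "k \<le> n"
    using k l by simp
  let ?p = "A (2*g + 1, 2*g + l)"
  have p: "?p \<in> carrier G"
    using k l by simp
  have "?p \<otimes> ev (V k) = ev (V k) \<otimes> ?p"
  proof (rule commute_V[OF k(1) k' p])
    fix t assume "1 < t" "t < k"
    then have "conj_by (A (2*g + t, 2*g + k)) ?p = ?p"
      using k l by (intro conj_by_PR1) auto
    then show "?p \<otimes> A (2*g + t, 2*g + k) = A (2*g + t, 2*g + k) \<otimes> ?p"
      using \<open>1 < t\<close> \<open>t < k\<close> k l by (simp add: conj_by_fixed_iff)
  qed
  then have "conj_by (ev (V k)) ?p = ?p"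
    using p V_closed[OF k(1) k'] by (simp add: conj_by_fixed_iff)
  then have "conj_by (ev (D k)) ?p = ?p"
    unfolding ev_D[OF k(1) k'] using genus k l V_closed[OF k(1) k']
    by (intro fixes_later_strand[where q = "A (2*g + k, 2*g + l)" and \<beta> = "A (2*g, 2*g + l)"]
        conj_by_PR2 conj_by_PR3 conj_by_PR4)
       auto
  then show ?thesis
    using p k l ev_T[of l] in_words(4)[OF k(1) k'] generators
    by (simp only: conj_by_fixed_iff eval_word_closed)
qed

text \<open>For the first strand the left product in (TR) is empty, so the right-hand side
  is \<open>t\<^sub>2 \<cdots> t\<^sub>n\<close>.\<close>

lemma first_strand_relation:
  "ev (surface_word g (\<lambda>i. (i, 2*g + 1))) = ev (concat (map T [2..<n + 1]))"
proof -
  have "map (\<lambda>k. 2*g + k) [2..<n + 1] = [2*g + 1 + 1..<2*g + n + 1]"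
    by (rule nth_equalityI) (auto simp del: upt_Suc)
  moreover have "map T [2..<n + 1] = map (\<lambda>j. Agen (2*g + 1) j) (map (\<lambda>k. 2*g + k) [2..<n + 1])"
    by (simp del: upt_Suc)
  ultimately have "concat (map T [2..<n + 1]) =
      concat (map (\<lambda>j. Agen (2*g + 1) j) [2*g + 1 + 1..<2*g + n + 1])"
    by (simp only:)
  moreover have "(surface_word g (\<lambda>i. (i, 2*g + 1)),
      concat (map (\<lambda>l. Agen l (2*g + 1)) [2*g + 1..<2*g + 1]) @
      concat (map (\<lambda>j. Agen (2*g + 1) j) [2*g + 1 + 1..<2*g + n + 1])) \<in> TR g n"
    unfolding TR_def using strands by blast
  ultimately show ?thesis
    using relators by (simp add: braid_relations_def)
qed

text \<open>The surface relator is the only relator of the surface group, so this is what von Dyck's theorem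
  asks of the values of the section.\<close>

lemma surface_relation:
  assumes y: "\<And>i. i \<in> {1..2*g - 1} \<Longrightarrow> y i = A (i, 2*g + 1)"
    and y_last: "y (2*g) = ev (concat (map (Bword g) [1..<n + 1]))"
  shows "eval_word G y (surface_word g (\<lambda>i. i)) = \<one>"
proof -
  let ?ks = "[2..<n + 1]" and ?I = "braid_indices g n"
  let ?b = "A (2*g, 2*g + 1)" and ?a = "A (2*g - 1, 2*g + 1)"
  let ?c = "ev (surface_word (g - 1) (\<lambda>i. (i, 2*g + 1)))"
  let ?t = "ev (concat (map T ?ks))" and ?B = "ev (concat (map (Bword g) ?ks))"
    and ?D = "ev (concat (map D ?ks))"
  have words: "T k \<in> words ?I" "Bword g k \<in> words ?I" "D k \<in> words ?I" if "k \<in> set ?ks" for k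
    using that in_words by auto
  have a: "?a \<in> carrier G" and b: "?b \<in> carrier G"
    using genus strands by simp_all
  have closed: "?t \<in> carrier G" "?B \<in> carrier G" "?D \<in> carrier G"
    by (intro eval_word_closed[OF _ generators] concat_in_words words; assumption)+
  have cD: "?c \<in> carrier G \<and> ?c \<otimes> ?D = ?D \<otimes> ?c"
  proof (rule commute_surface_word[OF closed(3)])
    fix i assume i: "i \<in> {1..2 * (g - 1)}"
    then show A: "A (i, 2*g + 1) \<in> carrier G"
      using strands by (intro A_closed) auto
    show "A (i, 2*g + 1) \<otimes> ?D = ?D \<otimes> A (i, 2*g + 1)"
      using i A words generator_commutes_D
      by (intro eval_word_concat_intertwine[OF _ _ generators]) auto
  qed
  have tD: "?t \<otimes> ?D = ?B"
  proof (rule eval_word_concat_merge[OF words(1,3,2) generators])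
    fix k assume k: "k \<in> set ?ks"
    then have k': "1 < k" "k \<le> n"
      by auto
    have "ev (T k) \<otimes> ev (D k) = A (2*g + 1, 2*g + k) \<otimes> (inv A (2*g + 1, 2*g + k) \<otimes> ev (Bword g k))"
      using k' by (simp add: gen_def winv_def D_def)
    also have "\<dots> = ev (Bword g k)"
      using k eval_word_closed[OF words(2)[OF k] generators] by (intro cancel_left) auto
    finally show "ev (T k) \<otimes> ev (D k) = ev (Bword g k)" .
  next
    show "sorted_wrt (\<lambda>k l. ev (D k) \<otimes> ev (T l) = ev (T l) \<otimes> ev (D k)) ?ks"
      by (rule sorted_wrt_mono_rel[OF _ sorted_wrt_upt]) (use D_commutes_T in auto)
  qed
  have aB: "?a \<otimes> ?B = ?D \<otimes> ?a"
    using a words penultimate_generator_moves_B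
    by (intro eval_word_concat_intertwine[OF _ _ generators]) auto
  have rel: "inv ?b \<otimes> ?a \<otimes> ?b \<otimes> inv ?a \<otimes> ?c = ?t"
    using a b cD unfolding first_strand_relation[symmetric] surface_word_last[OF genus] by (simp add: m_assoc)
  have "[1..<n + 1] = 1 # ?ks"
    using strands by (simp add: upt_conv_Cons numeral_2_eq_2 del: upt_Suc)
  then have "y (2*g) = ?b \<otimes> ?B"
    using y_last by (simp add: Bword_def gen_def del: upt_Suc)
  moreover have "y (2*g - 1) = ?a"
    using y genus by simp
  moreover have "eval_word G y (surface_word (g - 1) (\<lambda>i. i)) = ?c"
    by (rule eval_surface_word_cong) (auto simp: y)
  ultimately have "eval_word G y (surface_word g (\<lambda>i. i)) =
      inv (?b \<otimes> ?B) \<otimes> ?a \<otimes> (?b \<otimes> ?B) \<otimes> inv ?a \<otimes> ?c"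
    using a b closed cD unfolding surface_word_last[OF genus] by (simp add: m_assoc)
  also have "\<dots> = \<one>"
    using cD by (intro surface_relation_transfer[OF a b _ closed rel tD aB]) auto
  finally show ?thesis .
qed

end

section \<open>The section of the projection to the first strand\<close>

theorem theorem6p1:
  fixes S :: "'a::topological_space set" and g n :: nat
    and x :: "nat \<Rightarrow> 'a"
    and \<A> :: "nat \<times> nat \<Rightarrow> (real \<Rightarrow> nat \<Rightarrow> 'a) set"
  assumes "closed_surface S" and "orientable_surface S" and "has_genus S g"
    and "g \<ge> 1" and "n \<ge> 1"
    and "x \<in> configuration_space n S"
    and "has_presentation (pure_braid_group n S x) \<A> (braid_indices g n) (braid_relations g n)"
    and "has_presentation (fundamental_group S (x 1)) (\<lambda>i. forget_to_first S (\<A> (i, 2*g + 1)))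
           {1..2*g} {(surface_word g (\<lambda>i. i), [])}"
    and "\<forall>(i, j) \<in> braid_indices g n. j > 2*g + 1 \<longrightarrow>
           forget_to_first S (\<A> (i, j)) = \<one>\<^bsub>fundamental_group S (x 1)\<^esub>"
  shows "\<exists>s \<in> hom (fundamental_group S (x 1)) (pure_braid_group n S x).
           (\<forall>i \<in> {1..2*g - 1}. s (forget_to_first S (\<A> (i, 2*g + 1))) = \<A> (i, 2*g + 1)) \<and>
           s (forget_to_first S (\<A> (2*g, 2*g + 1))) =
             eval_word (pure_braid_group n S x) \<A> (concat (map (Bword g) [1..<n + 1])) \<and>
           (\<forall>c \<in> carrier (fundamental_group S (x 1)). forget_to_first S (s c) = c)"
proof -
  let ?P = "pure_braid_group n S x" and ?F = "fundamental_group S (x 1)" and ?p = "forget_to_first S"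
  let ?a = "\<lambda>i. ?p (\<A> (i, 2*g + 1))"
  let ?Bs = "concat (map (Bword g) [1..<n + 1])"
  have "x 1 \<in> S"
    using assms(5,6) by (auto simp: configuration_space_def PiE_iff)
  then interpret F: group ?F
    by (rule group_fundamental_group)
  interpret P: group ?P
    unfolding pure_braid_group_def using assms(6) by (rule group_fundamental_group)
  have p: "?p \<in> hom ?P ?F"
    by (rule forget_to_first_hom[OF assms(5)])
  have \<A>: "\<A> \<in> braid_indices g n \<rightarrow> carrier ?P"
    using assms(7) by (simp add: has_presentation_def)
  interpret surface_braid_relators ?P \<A> g n
    using assms(4,5) \<A> has_presentation_relators[OF assms(7)] by unfold_locales auto
  define y where "y i = (if i = 2*g then ev ?Bs else \<A> (i, 2*g + 1))" for i
  have B1: "?Bs = Agen (2*g) (2*g + 1) @ concat (map (Bword g) [2..<n + 1])"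
    using assms(5) by (simp add: upt_conv_Cons numeral_2_eq_2 Bword_def del: upt_Suc)
  have rest: "concat (map (Bword g) [2..<n + 1]) \<in> words (braid_indices g n)"
    using in_words(2) by (auto intro!: concat_in_words)
  then have Bs: "?Bs \<in> words (braid_indices g n)"
    unfolding B1 using assms(4,5) braid_index by (simp add: gen_def)
  have y: "y \<in> {1..2*g} \<rightarrow> carrier ?P"
    using assms(5) Bs \<A> by (auto simp: y_def P.eval_word_closed simp del: upt_Suc)
  have "eval_word ?P y (surface_word g (\<lambda>i. i)) = \<one>\<^bsub>?P\<^esub>"
    by (rule surface_relation) (auto simp: y_def)
  then obtain s where s: "s \<in> hom ?F ?P"
    and s_eval: "\<And>w. w \<in> words {1..2*g} \<Longrightarrow> s (eval_word ?F ?a w) = eval_word ?P y w"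
    using von_Dyck[OF F.group_axioms P.group_axioms assms(8) y] by auto
  have a: "?a \<in> {1..2*g} \<rightarrow> carrier ?F"
    using assms(8) by (simp add: has_presentation_def)
  have s_gen: "s (?a i) = y i" if "i \<in> {1..2*g}" for i
  proof -
    have "?a i \<in> carrier ?F" "y i \<in> carrier ?P"
      using that a y by blast+
    then show ?thesis
      using s_eval[of "gen i"] that by (simp add: gen_def del: One_nat_def)
  qed
  have "?p (ev ?Bs) = ?a (2*g)"
  proof -
    have "?p (ev ?Bs) = eval_word ?F (\<lambda>i. ?p (\<A> i)) ?Bs"
      by (rule eval_word_hom[OF P.group_axioms F.group_axioms p Bs \<A>])
    also have "\<dots> = ?a (2*g) \<otimes>\<^bsub>?F\<^esub> eval_word ?F (\<lambda>i. ?p (\<A> i)) (concat (map (Bword g) [2..<n + 1]))"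
      unfolding B1 by (simp add: gen_def)
    also have "eval_word ?F (\<lambda>i. ?p (\<A> i)) (concat (map (Bword g) [2..<n + 1])) = \<one>\<^bsub>?F\<^esub>"
    proof (rule F.eval_word_eq_one)
      \<comment> \<open>Every letter of \<open>B\<^sub>k\<close> has second index \<open>j\<^sub>k\<close>, which exceeds \<open>j\<^sub>1\<close> for \<open>k \<ge> 2\<close>.\<close>
      fix l assume l: "l \<in> set (concat (map (Bword g) [2..<n + 1]))"
      then have "fst l \<in> braid_indices g n"
        using l rest in_listsD[of _ "braid_indices g n \<times> UNIV"] unfolding words_def
        by (metis mem_Times_iff)
      moreover have "snd (fst l) > 2*g + 1"
        using l by (auto simp: Bword_def gen_def)
      ultimately show "?p (\<A> (fst l)) = \<one>\<^bsub>?F\<^esub>"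
        using assms(9) by (cases "fst l") auto
    qed
    finally show ?thesis
      using a assms(4) by (simp add: Pi_iff del: One_nat_def)
  qed
  then have p_y: "?p (y i) = ?a i" for i
    by (simp add: y_def)
  have "?p (s c) = c" if "c \<in> carrier ?F" for c
  proof -
    have "c \<in> eval_word ?F ?a ` words {1..2*g}"
      using that assms(8) by (simp only: has_presentation_def)
    then obtain w where c: "c = eval_word ?F ?a w" and w: "w \<in> words {1..2*g}"
      by (rule imageE)
    have "?p (s c) = eval_word ?F (\<lambda>i. ?p (y i)) w"
      unfolding c s_eval[OF w] by (rule eval_word_hom[OF P.group_axioms F.group_axioms p w y])
    then show ?thesis
      by (simp only: p_y c)
  qed
  moreover have "s (?a i) = \<A> (i, 2*g + 1)" if "i \<in> {1..2*g - 1}" for i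
    using that assms(4) s_gen[of i] unfolding y_def by (cases "i = 2*g") auto
  moreover have "s (?a (2*g)) = ev ?Bs"
    using assms(4) s_gen[of "2*g"] by (simp add: y_def)
  ultimately show ?thesis
    using s by blast
qed

end
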